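(* For all integers $k \geq 2$ and $r \geq 2k$, there exists a $k$-regular $0,1$ matrix $M$ satisfying \[\mathrm{rank}_{\mathrm{bin}}(M) = r\quad\text{and}\quad \mathrm{rank}_{\mathrm{bin}}(\overline{M}) \leq \Big \lceil \frac{k+1}{2k} \cdot r\Big \rceil + (2k-3).\]
   Context: A square $0,1$ matrix is $k$-regular if every row and every column has precisely $k$ ones. The complement $\overline{M}$ of a $0,1$ matrix $M$ is obtained by replacing ones by zeros and zeros by ones. The binary rank $\mathrm{rank}_{\mathrm{bin}}(A)$ of an $n\times n$ $0,1$ matrix $A$ is the smallest $r$ such that $A=A_1A_2$ (over the reals) with $A_1,A_2$ being $0,1$ matrices of dimensions $n\times r$ and $r\times n$; equivalently, the smallest number of combinatorial rectangles (all-one submatrices indexed by a set of rows times a set of columns) that partition the ones of $A$. *)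

theory Defs
  imports Complex_Main "Jordan_Normal_Form.Matrix"
begin

definition zero_one_mat :: "real mat \<Rightarrow> bool" where
  "zero_one_mat A \<longleftrightarrow> (\<forall>i < dim_row A. \<forall>j < dim_col A. A $$ (i, j) = 0 \<or> A $$ (i, j) = 1)"

definition regular_mat :: "nat \<Rightarrow> real mat \<Rightarrow> bool" where
  "regular_mat k A \<longleftrightarrow>
     square_mat A \<and> zero_one_mat A \<and>
     (\<forall>i < dim_row A. card {j. j < dim_col A \<and> A $$ (i, j) = 1} = k) \<and>
     (\<forall>j < dim_col A. card {i. i < dim_row A \<and> A $$ (i, j) = 1} = k)"

definition complement_mat :: "real mat \<Rightarrow> real mat" where
  "complement_mat A = map_mat (\<lambda>x. 1 - x) A"

definition binary_factorization :: "real mat \<Rightarrow> nat \<Rightarrow> bool" where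
  "binary_factorization A r \<longleftrightarrow>
     (\<exists>A1 A2. A1 \<in> carrier_mat (dim_row A) r \<and> A2 \<in> carrier_mat r (dim_col A) \<and>
        zero_one_mat A1 \<and> zero_one_mat A2 \<and> A = A1 * A2)"

definition binary_rank :: "real mat \<Rightarrow> nat" where
  "binary_rank A = (LEAST r. binary_factorization A r)"

text \<open>The minimum is attained for every 0,1 matrix, so \<^const>\<open>binary_rank\<close> is meaningful on them.\<close>

lemma binary_factorization_dim_col:
  assumes "zero_one_mat A"
  shows "binary_factorization A (dim_col A)"
  unfolding binary_factorization_def
proof (intro exI conjI)
  show "A \<in> carrier_mat (dim_row A) (dim_col A)" by auto
  show "zero_one_mat (1\<^sub>m (dim_col A))" by (auto simp: zero_one_mat_def)
qed (use assms in auto)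

lemma binary_factorization_binary_rank:
  assumes "zero_one_mat A"
  shows "binary_factorization A (binary_rank A)"
  unfolding binary_rank_def by (rule LeastI, rule binary_factorization_dim_col[OF assms])

lemma zero_one_complement_mat:
  assumes "zero_one_mat A"
  shows "zero_one_mat (complement_mat A)"
  using assms by (auto simp: zero_one_mat_def complement_mat_def)

end

theory Submission
  imports Defs
begin

text \<open>
  Write r = 2km + s with s < 2k. The matrix M is block diagonal with m copies of the
  2k x 2k circulant whose first row is k ones followed by k zeros, and s all-one k x k blocks.
  The diagonal entries of the circulants, with one diagonal entry of each all-one block, form a
  fooling set of size r, and M has r distinct rows.

  In every row of a circulant, exactly one of the columns c, c + k contains a one, for each c < k.
  Let e(b,j) be the unit row vector of column j of block b, and for each circulant block b let
  X(b) be the 0,1 vector of the columns 0, ..., k-1, 2k-1 of b. Every row of the complement is a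
  sum of distinct vectors among the following m(k+1) + s + (k-1) ones:
  \<^item> y(c), the sum of e(b,c+k) over all circulant blocks b, for c < k-1;
  \<^item> z(b,c), which is y(c) with e(b,c+k) replaced by e(b,c), for b < m and c < k-1;
  \<^item> for b < m, the two vectors e(b,k-1) + T(b) and e(b,2k-1) + T(b), where T(b) is the sum of
    X(b') over the circulant blocks b' other than b, plus all columns of the all-one blocks;
  \<^item> for each all-one block b, the sum of all X(b') plus all columns of the other all-one blocks.

  Since s < 2k, this number is at most the required bound.
\<close>

section \<open>Matrices of relations and bounds on their binary rank\<close>

definition relation_mat :: "'a list \<Rightarrow> ('a \<Rightarrow> 'a \<Rightarrow> bool) \<Rightarrow> real mat" where
  "relation_mat xs P = mat (length xs) (length xs) (\<lambda>(i, j). of_bool (P (xs ! i) (xs ! j)))"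

lemma relation_mat_simps [simp]:
  "dim_row (relation_mat xs P) = length xs"
  "dim_col (relation_mat xs P) = length xs"
  "i < length xs \<Longrightarrow> j < length xs \<Longrightarrow>
     relation_mat xs P $$ (i, j) = of_bool (P (xs ! i) (xs ! j))"
  by (auto simp: relation_mat_def)

lemma zero_one_relation_mat: "zero_one_mat (relation_mat xs P)"
  by (auto simp: zero_one_mat_def)

lemma complement_relation_mat:
  "complement_mat (relation_mat xs P) = relation_mat xs (\<lambda>x y. \<not> P x y)"
  by (rule eq_matI) (auto simp: complement_mat_def)

lemma card_nth_Collect:
  assumes "distinct xs"
  shows "card {i. i < length xs \<and> Q (xs ! i)} = card {x \<in> set xs. Q x}"
proof (rule bij_betw_same_card[of "nth xs"])
  show "bij_betw (nth xs) {i. i < length xs \<and> Q (xs ! i)} {x \<in> set xs. Q x}"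
    using assms by (auto simp: bij_betw_def inj_on_def nth_eq_iff_index_eq in_set_conv_nth)
qed

lemma regular_relation_mat:
  assumes "distinct xs"
    and "\<And>x. x \<in> set xs \<Longrightarrow> card {y \<in> set xs. P x y} = k"
    and "\<And>y. y \<in> set xs \<Longrightarrow> card {x \<in> set xs. P x y} = k"
  shows "regular_mat k (relation_mat xs P)"
proof -
  have "card {j. j < length xs \<and> relation_mat xs P $$ (i, j) = 1} = k"
    if "i < length xs" for i
  proof -
    have "{j. j < length xs \<and> relation_mat xs P $$ (i, j) = 1}
        = {j. j < length xs \<and> P (xs ! i) (xs ! j)}"
      using that by auto
    then show ?thesis
      using card_nth_Collect[OF assms(1), of "P (xs ! i)"] assms(2)[of "xs ! i"] that by simp
  qed
  moreover have "card {i. i < length xs \<and> relation_mat xs P $$ (i, j) = 1} = k"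
    if "j < length xs" for j
  proof -
    have "{i. i < length xs \<and> relation_mat xs P $$ (i, j) = 1}
        = {i. i < length xs \<and> P (xs ! i) (xs ! j)}"
      using that by auto
    then show ?thesis
      using card_nth_Collect[OF assms(1), of "\<lambda>x. P x (xs ! j)"] assms(3)[of "xs ! j"] that by simp
  qed
  ultimately show ?thesis
    by (simp add: regular_mat_def zero_one_relation_mat)
qed

text \<open>Each \<open>t\<close> in \<open>R\<close> stands for a rectangle: the rows
  \<open>x\<close> with \<open>U x t\<close> times the columns \<open>y\<close> with
  \<open>V t y\<close>. A product entry counts the rectangles through it, so \<open>cover\<close>
  says that they partition the ones.\<close>

lemma binary_factorization_relation_mat:
  fixes U :: "'a \<Rightarrow> 'b \<Rightarrow> bool" and V :: "'b \<Rightarrow> 'a \<Rightarrow> bool"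
  assumes "finite R"
    and cover: "\<And>x y. x \<in> set xs \<Longrightarrow> y \<in> set xs \<Longrightarrow>
      card {t \<in> R. U x t \<and> V t y} = of_bool (P x y)"
  shows "binary_factorization (relation_mat xs P) (card R)"
proof -
  obtain ts where ts: "distinct ts" "set ts = R"
    using finite_distinct_list[OF assms(1)] by blast
  then have len: "length ts = card R"
    using distinct_card by force
  define A1 :: "real mat" where
    "A1 = mat (length xs) (card R) (\<lambda>(i, l). of_bool (U (xs ! i) (ts ! l)))"
  define A2 :: "real mat" where
    "A2 = mat (card R) (length xs) (\<lambda>(l, j). of_bool (V (ts ! l) (xs ! j)))"
  have "relation_mat xs P = A1 * A2"
  proof (rule eq_matI)
    fix i j assume "i < dim_row (A1 * A2)" "j < dim_col (A1 * A2)"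
    then have ij: "i < length xs" "j < length xs"
      by (auto simp: A1_def A2_def)
    let ?Q = "\<lambda>t. U (xs ! i) t \<and> V t (xs ! j)"
    have "(A1 * A2) $$ (i, j)
        = (\<Sum>l<card R. of_bool (U (xs ! i) (ts ! l)) * of_bool (V (ts ! l) (xs ! j)))"
      using ij by (simp add: A1_def A2_def scalar_prod_def atLeast0LessThan)
    also have "\<dots> = (\<Sum>l<card R. of_bool (?Q (ts ! l)))"
      by (intro sum.cong) auto
    also have "\<dots> = real (card {l. l < card R \<and> ?Q (ts ! l)})"
      by (simp add: sum.If_cases of_bool_def lessThan_def Int_def)
    also have "\<dots> = real (card {t \<in> R. ?Q t})"
      using card_nth_Collect[OF ts(1), of ?Q] len ts(2) by simp
    also have "\<dots> = relation_mat xs P $$ (i, j)"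
      using ij cover[of "xs ! i" "xs ! j"] by simp
    finally show "relation_mat xs P $$ (i, j) = (A1 * A2) $$ (i, j)" by simp
  qed (auto simp: A1_def A2_def)
  moreover have "A1 \<in> carrier_mat (length xs) (card R)" "A2 \<in> carrier_mat (card R) (length xs)"
    "zero_one_mat A1" "zero_one_mat A2"
    by (auto simp: A1_def A2_def zero_one_mat_def)
  ultimately show ?thesis
    unfolding binary_factorization_def relation_mat_simps by blast
qed

text \<open>If one rectangle contained the diagonal entries of two elements of \<open>F\<close>, it
  would contain both mixed entries, against \<open>fooling\<close>. Choosing a rectangle for each
  diagonal entry is thus injective.\<close>

lemma fooling_set_le_binary_factorization:
  assumes "binary_factorization (relation_mat xs P) r"
    and "F \<subseteq> set xs"
    and diag: "\<And>x. x \<in> F \<Longrightarrow> P x x"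
    and fooling: "\<And>x y. x \<in> F \<Longrightarrow> y \<in> F \<Longrightarrow> P x y \<Longrightarrow> P y x \<Longrightarrow> x = y"
  shows "card F \<le> r"
proof -
  obtain A1 A2 where A: "A1 \<in> carrier_mat (length xs) r" "A2 \<in> carrier_mat r (length xs)"
    "zero_one_mat A1" "zero_one_mat A2" "relation_mat xs P = A1 * A2"
    using assms(1) by (auto simp: binary_factorization_def)
  have entry: "of_bool (P (xs ! i) (xs ! j)) = (\<Sum>l<r. A1 $$ (i, l) * A2 $$ (l, j))"
    if "i < length xs" "j < length xs" for i j
  proof -
    have "of_bool (P (xs ! i) (xs ! j)) = (A1 * A2) $$ (i, j)"
      using that by (simp flip: A(5))
    also have "\<dots> = (\<Sum>l<r. A1 $$ (i, l) * A2 $$ (l, j))"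
      using A(1,2) that by (simp add: scalar_prod_def atLeast0LessThan)
    finally show ?thesis .
  qed
  have nonneg: "A1 $$ (i, l) * A2 $$ (l, j) \<ge> 0" if "i < length xs" "j < length xs" "l < r" for i j l
  proof -
    have "A1 $$ (i, l) = 0 \<or> A1 $$ (i, l) = 1" "A2 $$ (l, j) = 0 \<or> A2 $$ (l, j) = 1"
      using A(1-4) that by (auto simp: zero_one_mat_def)
    then show ?thesis by auto
  qed
  \<comment> \<open>All terms are nonnegative, so nothing cancels: one nonzero term forces a nonzero
    entry.\<close>
  have one: "P (xs ! i) (xs ! j)"
    if "i < length xs" "j < length xs" "l < r" "A1 $$ (i, l) \<noteq> 0" "A2 $$ (l, j) \<noteq> 0" for i j l
  proof (rule ccontr)
    assume "\<not> P (xs ! i) (xs ! j)"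
    then have "(\<Sum>l<r. A1 $$ (i, l) * A2 $$ (l, j)) = 0"
      using entry[OF that(1,2)] by simp
    then have "A1 $$ (i, l) * A2 $$ (l, j) = 0"
      using nonneg that by (subst (asm) sum_nonneg_eq_0_iff) auto
    with that show False by simp
  qed
  have "\<exists>l<r. \<exists>i<length xs. xs ! i = x \<and> A1 $$ (i, l) \<noteq> 0 \<and> A2 $$ (l, i) \<noteq> 0"
    if x: "x \<in> F" for x
  proof -
    obtain i where i: "i < length xs" "xs ! i = x"
      using x assms(2) by (meson in_set_conv_nth subsetD)
    then have "(\<Sum>l<r. A1 $$ (i, l) * A2 $$ (l, i)) \<noteq> 0"
      using entry[of i i] diag[OF x] by simp
    then obtain l where "l < r" "A1 $$ (i, l) * A2 $$ (l, i) \<noteq> 0"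
      by (meson lessThan_iff sum.neutral)
    with i show ?thesis by auto
  qed
  then obtain f where f: "\<And>x. x \<in> F \<Longrightarrow> f x < r \<and>
      (\<exists>i<length xs. xs ! i = x \<and> A1 $$ (i, f x) \<noteq> 0 \<and> A2 $$ (f x, i) \<noteq> 0)"
    by metis
  have "inj_on f F"
  proof (rule inj_onI)
    fix x y assume xy: "x \<in> F" "y \<in> F" "f x = f y"
    from f[OF xy(1)] f[OF xy(2)] one xy(3) have "P x y" "P y x"
      by metis+
    with xy fooling show "x = y" by blast
  qed
  then have "card F \<le> card {..<r}"
    using f by (intro card_inj_on_le) auto
  then show ?thesis by simp
qed

section \<open>The circulant of order 2k\<close>

text \<open>Equivalent to (c - a) mod 2k < k for a, c < 2k.\<close>

definition circ :: "nat \<Rightarrow> nat \<Rightarrow> nat \<Rightarrow> bool" where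
  "circ k a c \<longleftrightarrow> a \<le> c \<and> c < a + k \<or> c + k < a"

lemma circ_add_k: "a < 2 * k \<Longrightarrow> c < k \<Longrightarrow> circ k a (c + k) \<longleftrightarrow> \<not> circ k a c"
  by (auto simp: circ_def)

text \<open>The offsets c - a and a - c sum to 0 modulo 2k, so both residues are below k only if
  both are 0.\<close>

lemma circ_antisym: "circ k a c \<Longrightarrow> circ k c a \<Longrightarrow> a < 2 * k \<Longrightarrow> c < 2 * k \<Longrightarrow> a = c"
  by (auto simp: circ_def)

lemma card_circ_row:
  assumes "a < 2 * k"
  shows "card {c. c < 2 * k \<and> circ k a c} = k"
\<comment> \<open>For a > k the cyclic interval of k columns starting at a wraps around.\<close>
proof (cases "a \<le> k")
  case True
  then have "{c. c < 2 * k \<and> circ k a c} = {a..<a + k}"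
    by (auto simp: circ_def)
  then show ?thesis by simp
next
  case False
  then have "{c. c < 2 * k \<and> circ k a c} = {a..<2 * k} \<union> {..<a - k}"
    using assms by (auto simp: circ_def)
  moreover have "card ({a..<2 * k} \<union> {..<a - k}) = (2 * k - a) + (a - k)"
    using assms by (subst card_Un_disjoint) auto
  ultimately show ?thesis using False assms by simp
qed

lemma card_circ_column:
  assumes "c < 2 * k"
  shows "card {a. a < 2 * k \<and> circ k a c} = k"
proof (cases "c < k")
  case True
  then have "{a. a < 2 * k \<and> circ k a c} = {..c} \<union> {c + k + 1..<2 * k}"
    by (auto simp: circ_def)
  moreover have "card ({..c} \<union> {c + k + 1..<2 * k}) = (c + 1) + (2 * k - (c + k + 1))"
    by (subst card_Un_disjoint) auto
  ultimately show ?thesis using True by simp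
next
  case False
  then have "{a. a < 2 * k \<and> circ k a c} = {c - k + 1..c}"
    using assms by (auto simp: circ_def)
  then show ?thesis using False by simp
qed

section \<open>The block matrix, its regularity and its binary rank\<close>

text \<open>Row and column indices are pairs (block, position); the blocks b < m are the circulants.\<close>

definition blocks :: "nat \<Rightarrow> nat \<Rightarrow> nat \<Rightarrow> (nat \<times> nat) set" where
  "blocks k m s = (SIGMA b:{..<m + s}. {..<if b < m then 2 * k else k})"

definition block_rel :: "nat \<Rightarrow> nat \<Rightarrow> nat \<times> nat \<Rightarrow> nat \<times> nat \<Rightarrow> bool" where
  "block_rel k m x y \<longleftrightarrow> fst x = fst y \<and> (fst x < m \<longrightarrow> circ k (snd x) (snd y))"

lemma finite_blocks: "finite (blocks k m s)"
  by (simp add: blocks_def)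

lemma card_block_rel_row:
  assumes "x \<in> blocks k m s"
  shows "card {y \<in> blocks k m s. block_rel k m x y} = k"
proof -
  obtain b a where x: "x = (b, a)" by (cases x)
  have "{y \<in> blocks k m s. block_rel k m x y}
      = Pair b ` (if b < m then {c. c < 2 * k \<and> circ k a c} else {..<k})"
    using assms by (auto simp: x blocks_def block_rel_def split: if_splits)
  moreover have "a < 2 * k"
    using assms by (auto simp: x blocks_def split: if_splits)
  ultimately show ?thesis
    by (simp add: card_image inj_on_def card_circ_row)
qed

lemma card_block_rel_column:
  assumes "y \<in> blocks k m s"
  shows "card {x \<in> blocks k m s. block_rel k m x y} = k"
proof -
  obtain b c where y: "y = (b, c)" by (cases y)
  have "{x \<in> blocks k m s. block_rel k m x y}
      = Pair b ` (if b < m then {a. a < 2 * k \<and> circ k a c} else {..<k})"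
    using assms by (auto simp: y blocks_def block_rel_def split: if_splits)
  moreover have "c < 2 * k"
    using assms by (auto simp: y blocks_def split: if_splits)
  ultimately show ?thesis
    by (simp add: card_image inj_on_def card_circ_column)
qed

lemma binary_rank_blocks:
  assumes "k > 0" and xs: "set xs = blocks k m s"
  shows "binary_rank (relation_mat xs (block_rel k m)) = 2 * k * m + s"
proof -
  \<comment> \<open>\<open>F\<close> serves both bounds: as a fooling set on the diagonal, and via
    \<open>rep\<close> as one representative of each class of equal rows.\<close>
  define F where "F = (SIGMA b:{..<m + s}. {..<if b < m then 2 * k else 1})"
  have "card F = (\<Sum>b<m + s. if b < m then 2 * k else 1)"
    by (simp add: F_def if_distrib cong: if_cong)
  also have "\<dots> = 2 * k * m + s"
    by (induction s) (auto simp: lessThan_Suc)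
  finally have card_F: "card F = 2 * k * m + s" .
  define rep where "rep x = (if fst x < m then x else (fst x, 0))" for x :: "nat \<times> nat"
  have "binary_factorization (relation_mat xs (block_rel k m)) (card F)"
  proof (rule binary_factorization_relation_mat)
    show "finite F" by (simp add: F_def)
    fix x y assume "x \<in> set xs"
    then have "x \<in> blocks k m s"
      unfolding xs .
    then have "rep x \<in> F"
      using \<open>k > 0\<close> by (cases x) (auto simp: F_def rep_def blocks_def)
    moreover have "block_rel k m (rep x) y \<longleftrightarrow> block_rel k m x y"
      by (auto simp: block_rel_def rep_def)
    ultimately have "{t \<in> F. t = rep x \<and> block_rel k m t y}
        = (if block_rel k m x y then {rep x} else {})"
      by auto
    then show "card {t \<in> F. t = rep x \<and> block_rel k m t y} = of_bool (block_rel k m x y)"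
      by simp
  qed
  moreover have "card F \<le> r" if "binary_factorization (relation_mat xs (block_rel k m)) r" for r
  proof (rule fooling_set_le_binary_factorization[OF that])
    show "F \<subseteq> set xs"
      unfolding xs F_def blocks_def using \<open>k > 0\<close> by (intro Sigma_mono) auto
    show "block_rel k m x x" if "x \<in> F" for x
      using \<open>k > 0\<close> by (simp add: block_rel_def circ_def)
    show "x = y" if "x \<in> F" "y \<in> F" "block_rel k m x y" "block_rel k m y x" for x y
      using that circ_antisym[of k "snd x" "snd y"]
      by (cases x; cases y; cases "fst x < m") (simp_all add: F_def block_rel_def)
  qed
  ultimately show ?thesis
    unfolding binary_rank_def card_F by (intro Least_equality)
qed

section \<open>The complement of the block matrix\<close>

lemma binary_rank_complement_blocks:
  assumes xs: "set xs = blocks (Suc q) m s"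
  shows "binary_rank (complement_mat (relation_mat xs (block_rel (Suc q) m))) \<le> m * (q + 2) + s + q"
proof -
  define k where "k = Suc q"
  \<comment> \<open>For d < m, the pair (d,c) stands for z(d,c) if c < k-1, and for the vectors e(d,k-1) + T(d) and
    e(d,2k-1) + T(d) if c is k-1 or k; block m + s is a dummy one that hosts the vectors y(c).\<close>
  define R where
    "R = {(d, c). d < m \<and> (c < q \<or> c = q \<or> c = k) \<or> m \<le> d \<and> d < m + s \<and> c = 0 \<or> d = m + s \<and> c < q}"
  \<comment> \<open>Row (b,a) of a circulant takes, for each c < k-1, y(c) if it has a one at c and
    z(b,c) otherwise. Both cover column c+k of every other circulant, and in block b whichever of c,
    c+k is a zero of the row. One vector with T(b) settles the pair k-1, 2k-1 of block b and all
    remaining columns. A row of an all-one block takes every y(c) and the vector of its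
    block.\<close>
  define U where "U x t = (case (x, t) of ((b, a), (d, c)) \<Rightarrow>
      if d < m then b = d \<and> (if c = k then circ k a q else \<not> circ k a c)
      else if d < m + s then b = d
      else b < m \<longrightarrow> circ k a c)" for x t :: "nat \<times> nat"
  \<comment> \<open>Since \<open>q\<close> is k-1, the condition
    \<open>a < k \<or> a = q + k\<close> describes X(b).\<close>
  define V where "V t y = (case (t, y) of ((d, c), (b, a)) \<Rightarrow>
      if d < m then
        if c < q then b < m \<and> (if b = d then a = c else a = c + k)
        else if b = d then a = (if c = q then q else q + k)
        else b < m \<longrightarrow> a < k \<or> a = q + k
      else if d < m + s then b \<noteq> d \<and> (b < m \<longrightarrow> a < k \<or> a = q + k)
      else b < m \<and> a = c + k)" for t y :: "nat \<times> nat"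
  have "R = (SIGMA b:{..m + s}. {..<if b < m then q + 2 else if b < m + s then 1 else q})"
    by (auto simp: R_def k_def split: if_splits)
  then have "finite R" and "card R = (\<Sum>b\<le>m + s. if b < m then q + 2 else if b < m + s then 1 else q)"
    by (simp_all add: if_distrib cong: if_cong)
  note this(2)
  also have "\<dots> = (\<Sum>b<m + s. if b < m then q + 2 else 1) + q"
    by (simp flip: lessThan_Suc_atMost) (rule sum.cong, auto)
  also have "(\<Sum>b<m + s. if b < m then q + 2 else 1) = m * (q + 2) + s"
    by (induction s) (auto simp: lessThan_Suc)
  finally have card_R: "card R = m * (q + 2) + s + q" .
  have "binary_factorization (relation_mat xs (\<lambda>x y. \<not> block_rel k m x y)) (card R)"
  proof (rule binary_factorization_relation_mat[OF \<open>finite R\<close>])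
    fix x y assume xy: "x \<in> set xs" "y \<in> set xs"
    obtain b a b' a' where eq: "x = (b, a)" "y = (b', a')"
      by (cases x, cases y)
    have bd: "b < m + s" "b' < m + s" "b < m \<Longrightarrow> a < 2 * k" "b' < m \<Longrightarrow> a' < 2 * k"
      using xy xs by (auto simp: eq blocks_def k_def split: if_splits)
    have flip: "circ k a (c + k) \<longleftrightarrow> \<not> circ k a c" if "b < m" "c < k" for c
      using circ_add_k bd that by auto
    let ?S = "{t \<in> R. U x t \<and> V t y}"
    have qk: "q < k" "\<And>c. c < q \<Longrightarrow> c < k" by (auto simp: k_def)
    consider (low) "b' < m" "a' < q" | (star) "b' < m" "a' = q"
      | (high) e where "b' < m" "a' = e + k" "e < q"
      | (star') "b' < m" "a' = q + k" | (J) "b' \<ge> m"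
    proof -
      have "a' < q \<or> a' = q \<or> (\<exists>e<q. a' = e + k) \<or> a' = q + k" if "b' < m"
        using bd(4)[OF that] by (auto simp: k_def) presburger
      then show thesis using that by (metis not_less)
    qed
    \<comment> \<open>The unique vector covering a zero is, in order of the branches: y(a'-k); the
      vector of an all-one block; the vector of block b with column a' of its own block; z(b,a'-k)
      reaching another block; the vector with T(b) taken by the row.\<close>
    then have "?S = (if block_rel k m x y then {} else
      {if b' < m \<and> k \<le> a' \<and> a' < q + k \<and> (b < m \<longrightarrow> circ k a (a' - k)) then (m + s, a' - k)
       else if m \<le> b then (b, 0)
       else if b' = b then (b, if a' < k then a' else k)
       else if b' < m \<and> k \<le> a' \<and> a' < q + k then (b, a' - k)
       else (b, if circ k a q then k else q)})"
    proof cases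
      case low
      then show ?thesis using bd qk 
        by (cases "b < m"; cases "b = b'"; simp add: eq block_rel_def;
            auto simp: R_def U_def V_def split: if_splits)
    next
      case star
      then show ?thesis using bd qk 
        by (cases "b < m"; cases "b = b'"; simp add: eq block_rel_def;
            auto simp: R_def U_def V_def split: if_splits)
    next
      case high
      then show ?thesis using bd qk flip[of e]
        by (cases "b < m"; cases "b = b'"; simp add: eq block_rel_def;
            auto simp: R_def U_def V_def split: if_splits)
    next
      case star'
      then show ?thesis using bd qk flip[of q]
        by (cases "b < m"; cases "b = b'"; simp add: eq block_rel_def;
            auto simp: R_def U_def V_def split: if_splits)
    next
      case J
      then show ?thesis using bd qk 
        by (cases "b < m"; cases "b = b'"; simp add: eq block_rel_def;
            auto simp: R_def U_def V_def split: if_splits)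
    qed
    then show "card ?S = of_bool (\<not> block_rel k m x y)"
      by simp
  qed
  then show ?thesis
    unfolding complement_relation_mat binary_rank_def card_R k_def by (rule Least_le)
qed

theorem theorem1p3:
  fixes k r :: nat
  assumes "k \<ge> 2" and "r \<ge> 2 * k"
  shows "\<exists>M. regular_mat k M \<and> binary_rank M = r \<and>
           int (binary_rank (complement_mat M))
             \<le> \<lceil>(real k + 1) / (2 * real k) * real r\<rceil> + (2 * int k - 3)"
proof -
  define m s where "m = r div (2 * k)" and "s = r mod (2 * k)"
  have r: "r = 2 * k * m + s" by (simp add: m_def s_def)
  have s: "s < 2 * k" using assms by (simp add: s_def)
  obtain xs where xs: "distinct xs" "set xs = blocks k m s"
    using finite_distinct_list[OF finite_blocks] by metis
  let ?M = "relation_mat xs (block_rel k m)"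
  have "regular_mat k ?M"
    using xs by (intro regular_relation_mat) (simp_all add: card_block_rel_row card_block_rel_column)
  moreover have "binary_rank ?M = r"
    using assms xs by (simp add: binary_rank_blocks r)
  moreover have "int (binary_rank (complement_mat ?M))
      \<le> \<lceil>(real k + 1) / (2 * real k) * real r\<rceil> + (2 * int k - 3)"
  proof -
    \<comment> \<open>Here s(k+1)/(2k) = s - s(k-1)/(2k) exceeds s - (k-1). Strictness gains one at
      the ceiling, and -(k-2) + (2k-3) = k-1 is exactly the number of vectors y(c) once
      \<open>q\<close> replaces k-1.\<close>
    have "real s * (real k - 1) < 2 * real k * (real k - 1)"
      using s assms by (intro mult_strict_right_mono) auto
    then have "real m * (real k + 1) + real s + 2 - real k - 1
        < (real k + 1) / (2 * real k) * real r"
      using assms by (simp add: r field_simps)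
    then have "int m * (int k + 1) + int s + 2 - int k
        \<le> \<lceil>(real k + 1) / (2 * real k) * real r\<rceil>"
      by (simp add: le_ceiling_iff)
    moreover obtain q where q: "k = Suc q"
      using assms by (cases k) auto
    have "int (binary_rank (complement_mat ?M)) \<le> int (m * (q + 2) + s + q)"
      using binary_rank_complement_blocks[of xs q m s] xs q
      by (intro of_nat_mono) simp
    ultimately show ?thesis
      by (simp add: q algebra_simps)
  qed
  ultimately show ?thesis by blast
qed

end
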